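(* With open sets being the names $Q$ with $\eta\,Q\,\mathit{Region}$ and interior operator $\mathit{InteriorG}$, the following hold: (1) $\mathit{InteriorG}\,\mathit{Gspace}\equiv\mathit{Gspace}$; (2) for every $Q$ with $\eta\,Q\,\mathit{Region}$: $\mathit{InteriorG}\,Q\equiv Q$; (3) for every $Q$ with $\eta\,Q\,\mathit{Region}$: $\mathit{InteriorG}\,(\mathit{InteriorG}\,Q)\equiv\mathit{InteriorG}\,Q$; (4) for all $A,B$ with $\eta\,A\,\mathit{Region}$ and $\eta\,B\,\mathit{Region}$, and all $P,Q,R$: if $P\equiv\mathit{InteriorG}\,A$, $Q\equiv\mathit{InteriorG}\,B$ and $R\equiv\mathit{b\_product}\,A\,B$, then $\mathit{b\_product}\,P\,Q\equiv\mathit{InteriorG}\,R$.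
   Context: Setting: a Coq formalization (classical logic) of Leśniewski's Ontology and Mereology extended with Tarski's geometry of solids. Names form a type $N$ with a primitive relation $\eta:N\to N\to\mathrm{Prop}$ satisfying Leśniewski's ontological axiom $\eta\,A\,b \leftrightarrow ((\exists C,\eta\,C\,A)\wedge(\forall C\,D,\eta\,C\,A\wedge\eta\,D\,A\to\eta\,C\,D)\wedge(\forall C,\eta\,C\,A\to\eta\,C\,b))$; $A$ is an individual iff $\eta\,A\,A$; $\eta\,P\,(a\cap b)\leftrightarrow(\eta\,P\,a\wedge\eta\,P\,b)$; $a\subseteq b$ means $\forall P,\eta\,P\,a\to\eta\,P\,b$; $P\equiv Q$ means $\eta\,P\,Q\wedge\eta\,Q\,P$. Mereology: $pt:N\to N$ ($\eta\,B\,(pt\,A)$: $B$ is a part of $A$) satisfying Leśniewski's mereology axioms (part-of a partial order on individuals; every non-empty name has a unique m-class). M-class: $\eta\,A\,(klass\,a)$ iff $\eta\,A\,A$, $\forall B,\eta\,B\,a\to\eta\,B\,(pt\,A)$, and $\forall B,\eta\,B\,(pt\,A)\to\exists C\,D,\eta\,C\,a\wedge\eta\,D\,(pt\,C)\wedge\eta\,D\,(pt\,B)$. Meet: $\eta\,R\,(\mathit{b\_product}\,P\,Q)$ iff $\eta\,P\,P\wedge\eta\,Q\,Q\wedge\eta\,R\,(klass\,((pt\,P)\cap(pt\,Q)))$. $X$ is exterior to $Y$ iff they have no common part. Geometry: $\mathit{balls}$ is a primitive name (there exists at least one ball); $\eta\,P\,\mathit{Gspace}$ iff $\eta\,P\,(klass\,\mathit{balls})$.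 Tarski's definitions for balls: $A$ is externally tangent to $B$ iff $A$ is exterior to $B$ and for any balls $X,Y$ both having $A$ as part and both exterior to $B$, one of $X,Y$ is part of the other; $A$ is internally tangent to $B$ iff $A$ is a proper part of $B$ and for any balls $X,Y$ both having $A$ as a part and both parts of $B$, one of $X,Y$ is part of the other; $A,B$ are externally diametrical w.r.t. $C$ iff both are externally tangent to $C$ and for any balls $X,Y$ exterior to $C$ with $A$ part of $X$ and $B$ part of $Y$, $X$ is exterior to $Y$; $A,B$ are internally diametrical w.r.t. $C$ iff both are internally tangent to $C$ and for any balls $X,Y$ externally tangent to $C$ with $A$ exterior to $X$ and $B$ exterior to $Y$, $X$ is exterior to $Y$; $A$ is concentric with $B$ iff $A=B$, or $A$ is a proper part of $B$ and any balls $X,Y$ externally diametrical w.r.t. $A$ and internally tangent to $B$ are internally diametrical w.r.t. $B$, or the same holds with $A,B$ interchanged. $\eta\,P\,(\mathit{Concent}\,Q)$ iff $P,Q$ are balls and $P$ is concentric with $Q$. Point: $\eta\,P\,(\mathit{Point}\,Q)$ iff $\eta\,P\,\mathit{balls}\wedge\eta\,Q\,\mathit{balls}\wedge\eta\,P\,(\mathit{Concent}\,Q)$. Region: $\eta\,P\,\mathit{Region}$ iff $\eta\,P\,P$ and $\exists b,\ b\subseteq\mathit{balls}\wedge\eta\,P\,(klass\,b)$. Saturated interior point: $\eta\,P\,(\mathit{sat\_InteriorPoint}\,Q)$ iff $\eta\,Q\,\mathit{Region}$ and $\exists P',\ \eta\,P\,(\mathit{Point}\,P')\wedge\eta\,P'\,(pt\,Q)\wedge(\eta\,P'\,(pt\,P)\to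 P\equiv P')$. Geometric interior: $\eta\,P\,(\mathit{InteriorG}\,Q)$ iff $\eta\,P\,(klass\,(\mathit{sat\_InteriorPoint}\,Q))$.
   Formalization: Clause (4) additionally assumes that the meet R is a Region: without it the clause fails (balls {0,1} and {1,2} with part = inclusion have meet {1}, not a sum of balls, so its InteriorG is empty), and it fails whenever R is not a Region. *)

theory Defs
  imports Main
begin

text \<open>
  Names are the elements of an arbitrary type. Every name-forming functor (\<open>cap\<close>, \<open>pt\<close>, \<open>klass\<close>, ...)
  is a total function on names of which only the extension with respect to \<open>eta\<close> is specified;
  extensionally equal names need not be equal in HOL.
\<close>

locale ontology =
  fixes eta :: "'n \<Rightarrow> 'n \<Rightarrow> bool"
    and cap :: "'n \<Rightarrow> 'n \<Rightarrow> 'n"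
  assumes ontological_axiom:
      "eta A b \<longleftrightarrow>
        (\<exists>C. eta C A) \<and> (\<forall>C D. eta C A \<and> eta D A \<longrightarrow> eta C D) \<and> (\<forall>C. eta C A \<longrightarrow> eta C b)"
    and cap_iff: "eta P (cap a b) \<longleftrightarrow> eta P a \<and> eta P b"

definition name_incl :: "('n \<Rightarrow> 'n \<Rightarrow> bool) \<Rightarrow> 'n \<Rightarrow> 'n \<Rightarrow> bool" where
  "name_incl eta a b \<longleftrightarrow> (\<forall>P. eta P a \<longrightarrow> eta P b)"

definition same :: "('n \<Rightarrow> 'n \<Rightarrow> bool) \<Rightarrow> 'n \<Rightarrow> 'n \<Rightarrow> bool" where
  "same eta P Q \<longleftrightarrow> eta P Q \<and> eta Q P"

text \<open>\<open>pt\<close> is the improper (that is, reflexive) part-of relation.\<close>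

locale mereology = ontology eta cap
  for eta :: "'n \<Rightarrow> 'n \<Rightarrow> bool" and cap :: "'n \<Rightarrow> 'n \<Rightarrow> 'n" +
  fixes pt :: "'n \<Rightarrow> 'n"
    and klass :: "'n \<Rightarrow> 'n"
    and b_product :: "'n \<Rightarrow> 'n \<Rightarrow> 'n"
  assumes pt_individual: "eta B (pt A) \<Longrightarrow> eta A A"
    and pt_refl: "eta A A \<Longrightarrow> eta A (pt A)"
    and pt_antisym: "eta A (pt B) \<Longrightarrow> eta B (pt A) \<Longrightarrow> same eta A B"
    and pt_trans: "eta A (pt B) \<Longrightarrow> eta B (pt C) \<Longrightarrow> eta A (pt C)"
    and klass_iff:
      "eta A (klass a) \<longleftrightarrow>
        eta A A \<and> (\<forall>B. eta B a \<longrightarrow> eta B (pt A)) \<and>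
        (\<forall>B. eta B (pt A) \<longrightarrow> (\<exists>C D. eta C a \<and> eta D (pt C) \<and> eta D (pt B)))"
    and klass_exists: "eta A a \<Longrightarrow> \<exists>B. eta B (klass a)"
    and klass_unique: "eta A (klass a) \<Longrightarrow> eta B (klass a) \<Longrightarrow> same eta A B"
    and b_product_iff:
      "eta R (b_product P Q) \<longleftrightarrow> eta P P \<and> eta Q Q \<and> eta R (klass (cap (pt P) (pt Q)))"

definition proper_part :: "('n \<Rightarrow> 'n \<Rightarrow> bool) \<Rightarrow> ('n \<Rightarrow> 'n) \<Rightarrow> 'n \<Rightarrow> 'n \<Rightarrow> bool" where
  "proper_part eta pt A B \<longleftrightarrow> eta A (pt B) \<and> \<not> same eta A B"

definition exterior :: "('n \<Rightarrow> 'n \<Rightarrow> bool) \<Rightarrow> ('n \<Rightarrow> 'n) \<Rightarrow> 'n \<Rightarrow> 'n \<Rightarrow> bool" where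
  "exterior eta pt X Y \<longleftrightarrow> \<not> (\<exists>Z. eta Z (pt X) \<and> eta Z (pt Y))"

text \<open>The predicates below are only ever applied to balls, so ballhood of the arguments is not repeated.\<close>

definition ext_tangent ::
  "('n \<Rightarrow> 'n \<Rightarrow> bool) \<Rightarrow> ('n \<Rightarrow> 'n) \<Rightarrow> 'n \<Rightarrow> 'n \<Rightarrow> 'n \<Rightarrow> bool" where
  "ext_tangent eta pt balls A B \<longleftrightarrow>
    exterior eta pt A B \<and>
    (\<forall>X Y. eta X balls \<and> eta Y balls \<and>
           eta A (pt X) \<and> eta A (pt Y) \<and> exterior eta pt X B \<and> exterior eta pt Y B
           \<longrightarrow> eta X (pt Y) \<or> eta Y (pt X))"

definition int_tangent ::
  "('n \<Rightarrow> 'n \<Rightarrow> bool) \<Rightarrow> ('n \<Rightarrow> 'n) \<Rightarrow> 'n \<Rightarrow> 'n \<Rightarrow> 'n \<Rightarrow> bool" where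
  "int_tangent eta pt balls A B \<longleftrightarrow>
    proper_part eta pt A B \<and>
    (\<forall>X Y. eta X balls \<and> eta Y balls \<and>
           eta A (pt X) \<and> eta A (pt Y) \<and> eta X (pt B) \<and> eta Y (pt B)
           \<longrightarrow> eta X (pt Y) \<or> eta Y (pt X))"

definition ext_diametrical ::
  "('n \<Rightarrow> 'n \<Rightarrow> bool) \<Rightarrow> ('n \<Rightarrow> 'n) \<Rightarrow> 'n \<Rightarrow> 'n \<Rightarrow> 'n \<Rightarrow> 'n \<Rightarrow> bool" where
  "ext_diametrical eta pt balls A B C \<longleftrightarrow>
    ext_tangent eta pt balls A C \<and> ext_tangent eta pt balls B C \<and>
    (\<forall>X Y. eta X balls \<and> eta Y balls \<and>
           exterior eta pt X C \<and> exterior eta pt Y C \<and> eta A (pt X) \<and> eta B (pt Y)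
           \<longrightarrow> exterior eta pt X Y)"

definition int_diametrical ::
  "('n \<Rightarrow> 'n \<Rightarrow> bool) \<Rightarrow> ('n \<Rightarrow> 'n) \<Rightarrow> 'n \<Rightarrow> 'n \<Rightarrow> 'n \<Rightarrow> 'n \<Rightarrow> bool" where
  "int_diametrical eta pt balls A B C \<longleftrightarrow>
    int_tangent eta pt balls A C \<and> int_tangent eta pt balls B C \<and>
    (\<forall>X Y. eta X balls \<and> eta Y balls \<and>
           ext_tangent eta pt balls X C \<and> ext_tangent eta pt balls Y C \<and>
           exterior eta pt A X \<and> exterior eta pt B Y
           \<longrightarrow> exterior eta pt X Y)"

text \<open>Identity of balls is identity of individuals, \<open>same\<close>, not equality in HOL.\<close>

definition concentric ::
  "('n \<Rightarrow> 'n \<Rightarrow> bool) \<Rightarrow> ('n \<Rightarrow> 'n) \<Rightarrow> 'n \<Rightarrow> 'n \<Rightarrow> 'n \<Rightarrow> bool" where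
  "concentric eta pt balls A B \<longleftrightarrow>
    same eta A B \<or>
    (proper_part eta pt A B \<and>
      (\<forall>X Y. eta X balls \<and> eta Y balls \<and> ext_diametrical eta pt balls X Y A \<and>
             int_tangent eta pt balls X B \<and> int_tangent eta pt balls Y B
             \<longrightarrow> int_diametrical eta pt balls X Y B)) \<or>
    (proper_part eta pt B A \<and>
      (\<forall>X Y. eta X balls \<and> eta Y balls \<and> ext_diametrical eta pt balls X Y B \<and>
             int_tangent eta pt balls X A \<and> int_tangent eta pt balls Y A
             \<longrightarrow> int_diametrical eta pt balls X Y A))"

locale solid_geometry = mereology eta cap pt klass b_product
  for eta :: "'n \<Rightarrow> 'n \<Rightarrow> bool"
    and cap :: "'n \<Rightarrow> 'n \<Rightarrow> 'n"
    and pt :: "'n \<Rightarrow> 'n"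
    and klass :: "'n \<Rightarrow> 'n"
    and b_product :: "'n \<Rightarrow> 'n \<Rightarrow> 'n" +
  fixes balls :: 'n
    and Gspace :: 'n
    and Concent :: "'n \<Rightarrow> 'n"
    and Point :: "'n \<Rightarrow> 'n"
    and Region :: 'n
    and sat_InteriorPoint :: "'n \<Rightarrow> 'n"
    and InteriorG :: "'n \<Rightarrow> 'n"
  assumes ball_exists: "\<exists>B. eta B balls"
    and Gspace_iff: "eta P Gspace \<longleftrightarrow> eta P (klass balls)"
    and Concent_iff:
      "eta P (Concent Q) \<longleftrightarrow> eta P balls \<and> eta Q balls \<and> concentric eta pt balls P Q"
    and Point_iff:
      "eta P (Point Q) \<longleftrightarrow> eta P balls \<and> eta Q balls \<and> eta P (Concent Q)"
    and Region_iff: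
      "eta P Region \<longleftrightarrow> eta P P \<and> (\<exists>b. name_incl eta b balls \<and> eta P (klass b))"
    and sat_InteriorPoint_iff:
      "eta P (sat_InteriorPoint Q) \<longleftrightarrow>
        eta Q Region \<and>
        (\<exists>P'. eta P (Point P') \<and> eta P' (pt Q) \<and> (eta P' (pt P) \<longrightarrow> same eta P P'))"
    and InteriorG_iff: "eta P (InteriorG Q) \<longleftrightarrow> eta P (klass (sat_InteriorPoint Q))"

end

theory Submission
  imports Defs
begin

text \<open>
  If \<open>P\<close> is concentric with a ball \<open>P'\<close> and \<open>P'\<close> is not a proper part of \<open>P\<close>, then \<open>P\<close> is
  a part of \<open>P'\<close>. Hence the saturated interior points of a region \<open>Q\<close> are exactly the balls that are
  parts of \<open>Q\<close>, and the m-class of these is \<open>Q\<close> itself. So the geometric interior is the identity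
  on regions, up to identity of individuals, and \<open>b_product\<close> respects that identity.
\<close>

context ontology
begin

lemma eta_trans: "eta A B \<Longrightarrow> eta B c \<Longrightarrow> eta A c"
  using ontological_axiom[of B c] by blast

lemma eta_individual: "eta A b \<Longrightarrow> eta A A"
  using ontological_axiom[of A b] ontological_axiom[of A A] by blast

lemma same_sym: "same eta A B \<Longrightarrow> same eta B A"
  by (simp add: same_def)

lemma same_trans: "same eta A B \<Longrightarrow> same eta B C \<Longrightarrow> same eta A C"
  unfolding same_def by (blast intro: eta_trans)

text \<open>By the ontological axiom, a name with exactly one element is itself an individual. This
  lets a functor value known only by its extension be treated as a singular name.\<close>

lemma same_unique_element:
  assumes "eta X a" and "\<And>Y. eta Y a \<Longrightarrow> same eta X Y"
  shows "same eta X a"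
proof -
  have "eta a X"
    using assms ontological_axiom[of a X] unfolding same_def by (blast intro: eta_trans)
  with assms(1) show ?thesis by (simp add: same_def)
qed

end

context mereology
begin

lemma same_imp_pt: "same eta A B \<Longrightarrow> eta A (pt B)"
  unfolding same_def by (blast intro: eta_trans eta_individual pt_refl)

lemma pt_cong: "same eta A B \<Longrightarrow> eta X (pt A) \<longleftrightarrow> eta X (pt B)"
  by (blast intro: same_imp_pt same_sym pt_trans)

lemma klass_cong: "(\<And>X. eta X a \<longleftrightarrow> eta X b) \<Longrightarrow> eta A (klass a) \<longleftrightarrow> eta A (klass b)"
  by (simp add: klass_iff)

text \<open>M-classes are unique. Here \<open>c\<close> stands for \<open>Gspace\<close>,
  \<open>InteriorG Q\<close> or \<open>b_product P Q\<close>, each coextensive with some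
  \<open>klass a\<close>.\<close>

lemma same_if_klass:
  assumes "\<And>Y. eta Y c \<longleftrightarrow> eta Y (klass a)" and "eta X (klass a)"
  shows "same eta X c"
  using assms by (blast intro: same_unique_element klass_unique)

lemma b_product_cong:
  assumes "same eta A P" and "same eta B Q"
  shows "eta X (b_product A B) \<longleftrightarrow> eta X (b_product P Q)"
proof -
  have "eta X (klass (cap (pt A) (pt B))) \<longleftrightarrow> eta X (klass (cap (pt P) (pt Q)))"
    by (rule klass_cong) (simp add: cap_iff pt_cong[OF assms(1)] pt_cong[OF assms(2)])
  moreover have "eta A A" "eta P P" "eta B B" "eta Q Q"
    using assms unfolding same_def by (blast intro: eta_individual)+
  ultimately show ?thesis by (simp add: b_product_iff)
qed

end

context solid_geometry
begin

lemma sat_InteriorPoint_iff_ball_part: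
  assumes "eta Q Region"
  shows "eta P (sat_InteriorPoint Q) \<longleftrightarrow> eta P balls \<and> eta P (pt Q)"
proof
  assume "eta P (sat_InteriorPoint Q)"
  then obtain P' where P': "eta P balls" "concentric eta pt balls P P'" "eta P' (pt Q)"
      "eta P' (pt P) \<longrightarrow> same eta P P'"
    by (auto simp: sat_InteriorPoint_iff Point_iff Concent_iff)
  \<comment> \<open>In the third case of \<open>concentric\<close>, \<open>P'\<close> is a proper
    part of \<open>P\<close>, which the saturation clause excludes.\<close>
  then have "eta P (pt P')"
    unfolding concentric_def proper_part_def by (blast intro: same_imp_pt same_sym)
  with P' show "eta P balls \<and> eta P (pt Q)" by (blast intro: pt_trans)
next
  assume P: "eta P balls \<and> eta P (pt Q)"
  then have "same eta P P" unfolding same_def by (blast intro: eta_individual)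
  \<comment> \<open>The ball \<open>P\<close> serves as its own witness \<open>P'\<close>.\<close>
  with P have "eta P (Point P)" by (simp add: Point_iff Concent_iff concentric_def)
  with P assms \<open>same eta P P\<close> show "eta P (sat_InteriorPoint Q)"
    by (auto simp: sat_InteriorPoint_iff)
qed

text \<open>Every member of the generating name \<open>b\<close> is a ball and a part of
  \<open>Q\<close>, so the overlap clause for \<open>b\<close> also holds for the larger name of all
  balls that are parts of \<open>Q\<close>.\<close>

lemma Region_eta_InteriorG:
  assumes "eta Q Region"
  shows "eta Q (InteriorG Q)"
proof -
  from assms obtain b where b: "name_incl eta b balls" "eta Q (klass b)" and "eta Q Q"
    by (auto simp: Region_iff)
  then show ?thesis
    unfolding InteriorG_iff klass_iff name_incl_def sat_InteriorPoint_iff_ball_part[OF assms]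
    by blast
qed

lemma same_Region_InteriorG: "eta Q Region \<Longrightarrow> same eta Q (InteriorG Q)"
  using same_if_klass[OF InteriorG_iff] Region_eta_InteriorG InteriorG_iff by blast

lemma Gspace_Region: "eta Gspace Region"
proof -
  from ball_exists klass_exists obtain G where G: "eta G (klass balls)" by blast
  then have "eta G Region"
    unfolding Region_iff name_incl_def by (blast intro: eta_individual)
  moreover have "same eta G Gspace" using same_if_klass[OF Gspace_iff G] .
  ultimately show ?thesis unfolding same_def by (blast intro: eta_trans)
qed

lemma InteriorG_Region: "eta Q Region \<Longrightarrow> eta (InteriorG Q) Region"
  using same_Region_InteriorG unfolding same_def by (blast intro: eta_trans)

text \<open>Both sides are identical with \<open>R\<close>. That \<open>R\<close> is a region
  matters: \<open>sat_InteriorPoint R\<close> is empty otherwise, and then so is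
  \<open>InteriorG R\<close>.\<close>

lemma InteriorG_b_product:
  assumes "eta A Region" "eta B Region" "eta R Region"
    and "same eta P (InteriorG A)" "same eta Q (InteriorG B)" "same eta R (b_product A B)"
  shows "same eta (b_product P Q) (InteriorG R)"
proof -
  have "same eta A P" "same eta B Q"
    using assms by (blast intro: same_trans same_sym same_Region_InteriorG)+
  note prod = b_product_cong[OF this]
  have "eta R (klass (cap (pt P) (pt Q)))"
    using assms(6) prod by (simp add: same_def b_product_iff)
  \<comment> \<open>\<open>prod[of R]\<close> yields that \<open>P\<close> and \<open>Q\<close> are
    individuals, which removes the side conditions in \<open>b_product_iff\<close>.\<close>
  moreover have "eta Y (b_product P Q) \<longleftrightarrow> eta Y (klass (cap (pt P) (pt Q)))" for Y
    using assms(6) prod[of R] by (simp add: same_def b_product_iff)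
  ultimately have "same eta R (b_product P Q)" by (blast intro: same_if_klass)
  then show ?thesis
    using assms(3) by (blast intro: same_trans same_sym same_Region_InteriorG)
qed

end

theorem theorem6:
  fixes eta :: "'n \<Rightarrow> 'n \<Rightarrow> bool"
    and cap :: "'n \<Rightarrow> 'n \<Rightarrow> 'n"
    and pt :: "'n \<Rightarrow> 'n"
    and klass :: "'n \<Rightarrow> 'n"
    and b_product :: "'n \<Rightarrow> 'n \<Rightarrow> 'n"
    and balls :: 'n
    and Gspace :: 'n
    and Concent :: "'n \<Rightarrow> 'n"
    and Point :: "'n \<Rightarrow> 'n"
    and Region :: 'n
    and sat_InteriorPoint :: "'n \<Rightarrow> 'n"
    and InteriorG :: "'n \<Rightarrow> 'n"
  assumes "solid_geometry eta cap pt klass b_product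
             balls Gspace Concent Point Region sat_InteriorPoint InteriorG"
  shows "same eta (InteriorG Gspace) Gspace \<and>
    (\<forall>Q. eta Q Region \<longrightarrow> same eta (InteriorG Q) Q) \<and>
    (\<forall>Q. eta Q Region \<longrightarrow> same eta (InteriorG (InteriorG Q)) (InteriorG Q)) \<and>
    (\<forall>A B P Q R. eta A Region \<and> eta B Region \<and> eta R Region \<and>
       same eta P (InteriorG A) \<and> same eta Q (InteriorG B) \<and> same eta R (b_product A B)
       \<longrightarrow> same eta (b_product P Q) (InteriorG R))"
proof -
  interpret solid_geometry eta cap pt klass b_product
      balls Gspace Concent Point Region sat_InteriorPoint InteriorG
    by (fact assms)
  show ?thesis
    using same_Region_InteriorG Gspace_Region InteriorG_Region InteriorG_b_product same_sym
    by meson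
qed

end
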